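(* Let $b,q\ge2$ be integers with $q<14$, let $(x_n)_{n\ge0}$ be the van der Corput-sequence in base $b$, and let $s_q$ denote the $q$-ary sum-of-digits function. Then there is a constant $C_{b,q}>0$ depending only on $b$ and $q$ such that for all sufficiently large $N$ $$D_N((x_{s_q(n)})_{n\ge0})\le \frac{C_{b,q}}{\sqrt{\log N}}.$$
   Context: For $n\in\mathbb{N}_0$ with base-$b$ digits $n=a_0+a_1b+a_2b^2+\cdots$, the van der Corput-sequence in base $b$ is $x_n=\varphi_b(n):=a_0/b+a_1/b^2+a_2/b^3+\cdots$. $s_q(n)$ is the sum of the base-$q$ digits of $n$. For a sequence $(y_n)_{n\ge0}$ in $[0,1)$ (points counted with multiplicity), $D_N((y_n)):=\sup_{[a,c)\subseteq[0,1)}\left|\frac{\#\{0\le n<N: y_n\in[a,c)\}}{N}-(c-a)\right|$. *)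

theory Defs
  imports "HOL-Analysis.Analysis"
begin

definition digit :: "nat \<Rightarrow> nat \<Rightarrow> nat \<Rightarrow> nat" where
  "digit b n i = n div b ^ i mod b"

definition van_der_corput :: "nat \<Rightarrow> nat \<Rightarrow> real" where
  "van_der_corput b n = (\<Sum>i. real (digit b n i) / real b ^ Suc i)"

(* For q \<ge> 2, the set {i. q ^ i \<le> n} is finite and contains every position of a nonzero digit. *)
definition digit_sum :: "nat \<Rightarrow> nat \<Rightarrow> nat" where
  "digit_sum q n = (\<Sum>i | q ^ i \<le> n. digit q n i)"

(* Counting indices rather than values counts the points with multiplicity.  The empty interval
   contributes 0 and is omitted; the family is bounded by 1, so the real-valued supremum is genuine. *)
definition discrepancy :: "nat \<Rightarrow> (nat \<Rightarrow> real) \<Rightarrow> real" where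
  "discrepancy N y =
     (SUP (a, c) \<in> {(a, c). 0 \<le> a \<and> a < c \<and> c \<le> 1}.
        \<bar>real (card {n. n < N \<and> y n \<in> {a..<c}}) / real N - (c - a)\<bar>)"

end

theory Submission
  imports Defs
begin

text \<open>
  Everything rests on the exponential sums \<open>S(N) = (\<Sum>n<N. z ^ s(n))\<close> with \<open>z\<close> on the unit
  circle. Splitting off the last digit gives \<open>S(q N + d) = P S(N) + O(q)\<close> with
  \<open>P = (\<Sum>j<q. z ^ j)\<close>, and \<open>\<bar>P\<bar> \<le> q - sin(t/2)\<^sup>2\<close> for \<open>z = cis t\<close>. Hence
  \<open>S(N) / N = O(1 / (L sin(t/2)\<^sup>2))\<close> when \<open>q ^ L \<le> N\<close>, and Fourier inversion modulo \<open>m\<close> shows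
  that \<open>s(n)\<close> hits each residue class modulo \<open>m\<close> with frequency \<open>1 / m + O(m / L)\<close>. Since this
  error grows geometrically along \<open>m = b ^ k\<close>, the errors of the elementary intervals which make up
  \<open>[0, j / b ^ K)\<close> add up to \<open>O(b ^ K / L)\<close>. The choice \<open>b ^ K \<approx> sqrt L\<close> balances this with the
  length \<open>1 / b ^ K\<close> of the elementary intervals.
\<close>

subsection \<open>Sum of digits\<close>

text \<open>Positions outside the defining index set have \<open>q ^ i > n\<close>, hence digit 0. A
  free bound \<open>k\<close> allows the digit sums of \<open>n\<close> and \<open>q * n + d\<close>
  to be compared by an index shift.\<close>

lemma digit_sum_eq_sum_lessThan:
  assumes "q \<ge> 2" "n < q ^ k"
  shows "digit_sum q n = (\<Sum>i<k. digit q n i)"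
  unfolding digit_sum_def
proof (rule sum.mono_neutral_left)
  show "{i. q ^ i \<le> n} \<subseteq> {..<k}"
  proof
    fix i assume "i \<in> {i. q ^ i \<le> n}"
    then have "q ^ i < q ^ k"
      using assms(2) by (metis le_less_trans mem_Collect_eq)
    then show "i \<in> {..<k}"
      using assms(1) by simp
  qed
qed (auto simp: digit_def)

lemma digit_Suc: "digit b n (Suc i) = digit b (n div b) i"
  by (simp add: digit_def div_mult2_eq)

lemma digit_sum_mult_add:
  assumes "q \<ge> 2" "d < q"
  shows "digit_sum q (q * n + d) = digit_sum q n + d"
proof -
  obtain k where k: "n < q ^ k"
    using assms less_exp[of n] power_mono[of 2 q n]
    by (meson dual_order.strict_trans1 le_less_trans less_le_trans zero_le_numeral)
  have "q * n + d < q * (n + 1)"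
    using assms by simp
  also have "\<dots> \<le> q * q ^ k"
    using k by (intro mult_le_mono) auto
  finally have "q * n + d < q ^ Suc k"
    by simp
  then have "digit_sum q (q * n + d) = (\<Sum>i<Suc k. digit q (q * n + d) i)"
    using assms by (intro digit_sum_eq_sum_lessThan)
  also have "\<dots> = digit q (q * n + d) 0 + (\<Sum>i<k. digit q n i)"
    using assms by (subst sum.lessThan_Suc_shift) (simp add: digit_Suc)
  also have "(\<Sum>i<k. digit q n i) = digit_sum q n"
    using assms k by (simp add: digit_sum_eq_sum_lessThan)
  finally show ?thesis
    using assms by (simp add: digit_def)
qed

text \<open>Write \<open>N = q * M + d\<close>. The complete blocks of length \<open>q\<close>
  contribute \<open>P\<close> times the sum up to \<open>M\<close>, and the incomplete block has at
  most \<open>q - 1\<close> terms of modulus 1. Unfolding this recursion gives the geometric sum in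
  \<open>norm P\<close>.\<close>

lemma norm_sum_power_digit_sum_le:
  fixes z :: complex
  assumes "q \<ge> 2" "norm z = 1" "N < q ^ Suc L"
  shows "norm (\<Sum>n<N. z ^ digit_sum q n) \<le> (real q - 1) * (\<Sum>i\<le>L. norm (\<Sum>j<q. z ^ j) ^ i)"
  using assms(3)
proof (induction L arbitrary: N)
  case 0
  have "norm (\<Sum>n<N. z ^ digit_sum q n) \<le> real (card {..<N}) * 1"
    by (rule sum_norm_bound) (simp add: norm_power assms)
  then show ?case
    using 0 by simp
next
  case (Suc L)
  define M d where "M = N div q" and "d = N mod q"
  define P where "P = (\<Sum>j<q. z ^ j)"
  have N: "N = q * M + d"
    by (simp add: M_def d_def)
  have "d < q"
    using assms by (simp add: d_def)
  have "M < q ^ Suc L"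
    using Suc.prems assms by (simp add: M_def div_less_iff_less_mult mult.commute)
  \<comment> \<open>The block of the numbers \<open>q * K + j\<close> with \<open>j < q\<close> has
    digit sums \<open>digit_sum q K + j\<close>, so a common factor \<open>P\<close> splits
    off.\<close>
  have "(\<Sum>n<q * K. z ^ digit_sum q n) = (\<Sum>n<K. z ^ digit_sum q n) * P" for K
  proof (induction K)
    case (Suc K)
    have "(\<Sum>n<q * Suc K. z ^ digit_sum q n) =
      (\<Sum>n<q * K. z ^ digit_sum q n) + (\<Sum>n=q*K..<q*K+q. z ^ digit_sum q n)"
      by (simp add: lessThan_atLeast0 sum.atLeastLessThan_concat add.commute)
    also have "(\<Sum>n=q*K..<q*K+q. z ^ digit_sum q n) = (\<Sum>j<q. z ^ digit_sum q (q * K + j))"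
      using sum.shift_bounds_nat_ivl[of "\<lambda>n. z ^ digit_sum q n" 0 "q * K" q]
      by (simp add: lessThan_atLeast0 add.commute)
    also have "\<dots> = z ^ digit_sum q K * P"
      using assms by (simp add: digit_sum_mult_add P_def power_add sum_distrib_left)
    finally show ?case
      using Suc by (simp add: algebra_simps)
  qed simp
  then have "(\<Sum>n<N. z ^ digit_sum q n) =
      (\<Sum>n<M. z ^ digit_sum q n) * P + (\<Sum>n=q*M..<N. z ^ digit_sum q n)"
    using sum.atLeastLessThan_concat[of 0 "q * M" N "\<lambda>n. z ^ digit_sum q n"] N
    by (simp add: lessThan_atLeast0)
  also have "norm \<dots> \<le> norm (\<Sum>n<M. z ^ digit_sum q n) * norm P + real (card {q*M..<N}) * 1"
    by (rule norm_triangle_le, rule add_mono)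
       (simp add: norm_mult, rule sum_norm_bound, simp add: norm_power assms)
  also have "\<dots> \<le> ((real q - 1) * (\<Sum>i\<le>L. norm P ^ i)) * norm P + (real q - 1)"
    using Suc.IH[OF \<open>M < q ^ Suc L\<close>] \<open>d < q\<close> unfolding P_def
    by (intro add_mono mult_right_mono) (auto simp: N)
  also have "\<dots> = (real q - 1) * (\<Sum>i\<le>Suc L. norm P ^ i)"
    by (subst sum.atMost_Suc_shift) (simp add: sum_distrib_left sum_distrib_right algebra_simps)
  finally show ?case
    by (simp add: P_def)
qed

section \<open>Cancellation in the exponential sums\<close>

lemma norm_one_plus_cis_le: "norm (1 + cis t) \<le> 2 - (sin (t / 2))\<^sup>2"
proof (rule power2_le_imp_le)
  have "(norm (1 + cis t))\<^sup>2 = 2 + 2 * cos t"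
    using sin_cos_squared_add[of t] by (simp add: cmod_power2 power2_sum)
  also have "cos t = 1 - 2 * (sin (t / 2))\<^sup>2"
    using cos_double_sin[of "t / 2"] by simp
  \<comment> \<open>With \<open>s\<close> for the squared sine, the left side is 4 - 4s and the
    right side is 4 - 4s + s^2.\<close>
  also have "2 + 2 * (1 - 2 * (sin (t / 2))\<^sup>2) \<le> (2 - (sin (t / 2))\<^sup>2)\<^sup>2"
    by (simp add: power2_diff)
  finally show "(norm (1 + cis t))\<^sup>2 \<le> (2 - (sin (t / 2))\<^sup>2)\<^sup>2" .
  have "(sin (t / 2))\<^sup>2 \<le> 1"
    by (simp add: abs_square_le_1)
  then show "0 \<le> 2 - (sin (t / 2))\<^sup>2"
    by linarith
qed

text \<open>Cancellation between the first two terms suffices; each of the other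
  \<open>q - 2\<close> terms has modulus 1.\<close>

lemma norm_sum_cis_power_le:
  assumes "q \<ge> 2"
  shows "norm (\<Sum>j<q. cis t ^ j) \<le> real q - (sin (t / 2))\<^sup>2"
proof -
  obtain p where q: "q = Suc (Suc p)"
    using le_Suc_ex[OF assms] by auto
  have "(\<Sum>j<q. cis t ^ j) = (1 + cis t) + (\<Sum>j<p. cis t ^ Suc (Suc j))"
    unfolding q by (subst sum.lessThan_Suc_shift, subst sum.lessThan_Suc_shift) (simp add: add.assoc)
  also have "norm \<dots> \<le> (2 - (sin (t / 2))\<^sup>2) + real (card {..<p}) * 1"
    by (rule norm_triangle_le, rule add_mono[OF norm_one_plus_cis_le], rule sum_norm_bound)
       (simp add: norm_mult norm_power)
  finally show ?thesis
    by (simp add: q)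
qed

text \<open>Bernoulli gives \<open>1 + n * x \<le> (1 + x) ^ n\<close>, and the product of
  \<open>(1 - x) ^ n\<close> and \<open>(1 + x) ^ n\<close> is at most 1. Trading exponential decay
  for this bound isolates the dependence on \<open>x\<close> as a factor 1/x, which can later be
  summed over all frequencies.\<close>

lemma one_minus_power_le:
  fixes x :: real
  assumes "0 < x" "x \<le> 1"
  shows "(1 - x) ^ n \<le> 1 / (real (Suc n) * x)"
proof -
  have "(1 - x) ^ n * (real (Suc n) * x) \<le> (1 - x) ^ n * (1 + real n * x)"
    using assms by (intro mult_left_mono) (auto simp: algebra_simps)
  also have "\<dots> \<le> (1 - x) ^ n * (1 + x) ^ n"
    using assms Bernoulli_inequality[of x n] by (intro mult_left_mono) auto
  also have "\<dots> = (1 - x\<^sup>2) ^ n"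
    by (simp add: power_mult_distrib[symmetric] power2_eq_square algebra_simps)
  also have "\<dots> \<le> 1"
    using assms by (intro power_le_one) (auto simp: abs_square_le_1)
  finally show ?thesis
    using pos_le_divide_eq[of "real (Suc n) * x" "(1 - x) ^ n" 1] assms by (simp del: of_nat_Suc)
qed

text \<open>The geometric growth of the numerators makes the last term dominate, so the decay
  1/(L+1) survives the summation.\<close>

lemma sum_power_div_Suc_le:
  fixes q :: real
  assumes "q \<ge> 2"
  shows "(\<Sum>i\<le>L. q ^ i / real (Suc i)) \<le> 4 * q ^ L / real (Suc L)"
proof (induction L)
  case (Suc L)
  show ?case
  proof (cases "L = 0")
    case True
    then show ?thesis
      using assms by simp
  next
    case False
    \<comment> \<open>This amounts to 4(L+2) \<le> 6(L+1), which needs L \<ge> 1. Three quarters of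
      the new bound absorb the old one, and the last quarter is exactly the new term.\<close>
    have "4 / real (Suc L) \<le> 3 * 2 / real (Suc (Suc L))"
      using False by (simp add: field_simps)
    also have "\<dots> \<le> 3 * q / real (Suc (Suc L))"
      using assms by (intro divide_right_mono) auto
    finally have "q ^ L * (4 / real (Suc L)) \<le> q ^ L * (3 * q / real (Suc (Suc L)))"
      using assms by (intro mult_left_mono) auto
    moreover have "4 * q ^ Suc L / real (Suc (Suc L)) =
        q ^ L * (3 * q / real (Suc (Suc L))) + q ^ Suc L / real (Suc (Suc L))"
      by (simp add: mult_ac del: of_nat_Suc flip: add_divide_distrib)
    moreover have "4 * q ^ L / real (Suc L) = q ^ L * (4 / real (Suc L))"
      by simp
    moreover have "(\<Sum>i\<le>Suc L. q ^ i / real (Suc i)) =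
        (\<Sum>i\<le>L. q ^ i / real (Suc i)) + q ^ Suc L / real (Suc (Suc L))"
      by simp
    ultimately show ?thesis
      using Suc by linarith
  qed
qed simp

lemma norm_sum_cis_digit_sum_le:
  assumes "q \<ge> 2" "q ^ L \<le> N" "N < q ^ Suc L" and sin: "sin (t / 2) \<noteq> 0"
  shows "norm (\<Sum>n<N. cis t ^ digit_sum q n)
    \<le> real N * (4 * (real q)\<^sup>2 / (real (Suc L) * (sin (t / 2))\<^sup>2))"
proof -
  \<comment> \<open>Normalised so that the factor for one digit has modulus at most
    \<open>q * (1 - x)\<close>.\<close>
  define x where "x = (sin (t / 2))\<^sup>2 / real q"
  have "(sin (t / 2))\<^sup>2 \<le> 1"
    by (simp add: abs_square_le_1)
  then have x: "0 < x" "x \<le> 1"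
    using assms by (auto simp: x_def field_simps)
  have P: "norm (\<Sum>j<q. cis t ^ j) \<le> real q * (1 - x)"
    using norm_sum_cis_power_le[OF assms(1), of t] assms
    by (simp add: x_def right_diff_distrib)
  have "norm (\<Sum>n<N. cis t ^ digit_sum q n)
      \<le> (real q - 1) * (\<Sum>i\<le>L. norm (\<Sum>j<q. cis t ^ j) ^ i)"
    using assms by (intro norm_sum_power_digit_sum_le) auto
  also have "\<dots> \<le> real q * (\<Sum>i\<le>L. real q ^ i / real (Suc i) * (1 / x))"
  proof (intro mult_mono sum_mono sum_nonneg)
    fix i
    have "norm (\<Sum>j<q. cis t ^ j) ^ i \<le> (real q * (1 - x)) ^ i"
      by (intro power_mono P) auto
    also have "\<dots> \<le> real q ^ i * (1 / (real (Suc i) * x))"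
      unfolding power_mult_distrib by (intro mult_left_mono one_minus_power_le x) auto
    finally show "norm (\<Sum>j<q. cis t ^ j) ^ i \<le> real q ^ i / real (Suc i) * (1 / x)"
      by simp
  qed auto
  also have "\<dots> = real q / x * (\<Sum>i\<le>L. real q ^ i / real (Suc i))"
    by (simp only: sum_distrib_right[symmetric]) simp
  also have "\<dots> \<le> real q / x * (4 * real N / real (Suc L))"
  proof (intro mult_left_mono)
    have "real q ^ L \<le> real N"
      using assms(2) by (metis of_nat_le_iff of_nat_power)
    then have "4 * real q ^ L / real (Suc L) \<le> 4 * real N / real (Suc L)"
      by (intro divide_right_mono) auto
    then show "(\<Sum>i\<le>L. real q ^ i / real (Suc i)) \<le> 4 * real N / real (Suc L)"
      using sum_power_div_Suc_le[of "real q" L] assms by linarith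
  qed (use x in auto)
  also have "\<dots> = real N * (4 * (real q)\<^sup>2 / (real (Suc L) * (sin (t / 2))\<^sup>2))"
    by (simp add: x_def power2_eq_square mult_ac)
  finally show ?thesis .
qed

subsection \<open>Residue classes\<close>

text \<open>Orthogonality of the additive characters modulo \<open>m\<close>: exchanging the roles
  of \<open>h\<close> and \<open>k\<close> gives a geometric sum in a root of unity \<open>w\<close>
  with \<open>w ^ m = 1\<close>, which vanishes unless \<open>w = 1\<close>.\<close>

lemma sum_cis_multiples:
  assumes "m > 0"
  shows "(\<Sum>h<m. cis (2 * pi * real h / real m) ^ k) = (if m dvd k then of_nat m else 0)"
proof -
  define w where "w = cis (2 * pi * real k / real m)"
  have w: "cis (2 * pi * real h / real m) ^ k = w ^ h" for h
    unfolding w_def Complex.DeMoivre by (rule arg_cong[of _ _ cis]) simp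
  have "w = 1 \<longleftrightarrow> m dvd k"
  proof
    assume "w = 1"
    then have "cos (2 * pi * real k / real m) = 1"
      by (simp add: w_def complex_eq_iff)
    then obtain i :: int where "2 * pi * real k / real m = of_int i * 2 * pi"
      by (auto simp: cos_one_2pi_int)
    then have "real k = of_int i * real m"
      using assms by (simp add: field_simps)
    then have "int k = i * int m"
      by (metis of_int_eq_iff of_int_mult of_int_of_nat_eq)
    then show "m dvd k"
      by (metis dvd_triv_right int_dvd_int_iff)
  next
    assume "m dvd k"
    then obtain i where "k = m * i" ..
    then show "w = 1"
      using assms cis_multiple_2pi[of "real i"] by (simp add: w_def mult.assoc)
  qed
  moreover have "w ^ m = 1"
    using assms cis_multiple_2pi[of "real k"] by (simp add: w_def Complex.DeMoivre mult.assoc)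
  ultimately show ?thesis
    unfolding w by (auto simp: geometric_sum)
qed

section \<open>Sums of inverse squared sines\<close>

lemma sin_pi_ge:
  assumes "0 \<le> x" "x \<le> 1 / 2"
  shows "sin (pi * x) \<ge> 2 * x"
proof -
  \<comment> \<open>Jordan's inequality: a concave function lies above its chord, here the one from
    0 to pi/2.\<close>
  have "concave_on {0..pi / 2} sin"
    by (rule f''_le0_imp_concave[where f' = cos and f'' = "\<lambda>x. - sin x"])
       (auto intro!: derivative_eq_intros sin_ge_zero)
  then have "(1 - 2 * x) * sin 0 + 2 * x * sin (pi / 2)
      \<le> sin ((1 - 2 * x) *\<^sub>R 0 + (2 * x) *\<^sub>R (pi / 2))"
    using assms by (intro concave_onD) auto
  then show ?thesis
    by (simp add: mult.commute)
qed

lemma sum_inverse_squares_le: "(\<Sum>h=1..<m. 1 / (real h)\<^sup>2) \<le> 2"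
proof -
  \<comment> \<open>The subtracted 1/n makes the induction work, since 1/(n+1)^2 \<le> 1/n -
    1/(n+1).\<close>
  have "(\<Sum>h=1..<Suc n. 1 / (real h)\<^sup>2) \<le> 2 - 1 / real n" if "n > 0" for n
    using that
  proof (induction n)
    case (Suc n)
    show ?case
    proof (cases "n = 0")
      case False
      have "1 / (real (Suc n))\<^sup>2 \<le> 1 / real n - 1 / real (Suc n)"
      proof -
        have "1 / (real (Suc n))\<^sup>2 \<le> 1 / (real n * real (Suc n))"
          using False by (intro divide_left_mono) (auto simp: power2_eq_square intro!: mult_pos_pos)
        also have "\<dots> = 1 / real n - 1 / real (Suc n)"
          using False by (simp add: field_simps)
        finally show ?thesis .
      qed
      then show ?thesis
        using Suc.IH False by simp
    qed simp
  qed simp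
  from this[of "m - 1"] show ?thesis
    by (cases "m \<le> 1") (auto intro: order_trans)
qed

lemma sum_inverse_sin_squares_le:
  "(\<Sum>h=1..<m. 1 / (sin (pi * real h / real m))\<^sup>2) \<le> (real m)\<^sup>2"
proof -
  have *: "1 / (sin (pi * real h / real m))\<^sup>2 \<le> (real m)\<^sup>2 / 4 * (1 / (real h)\<^sup>2)"
    if "h > 0" "2 * h \<le> m" for h
  proof -
    have "2 * (real h / real m) \<le> sin (pi * (real h / real m))"
      using that by (intro sin_pi_ge) (auto simp: field_simps)
    moreover have "0 < 2 * (real h / real m)"
      using that by simp
    ultimately have "1 / (sin (pi * real h / real m))\<^sup>2 \<le> 1 / (2 * (real h / real m))\<^sup>2"
      by (intro divide_left_mono power_mono mult_pos_pos zero_less_power) auto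
    then show ?thesis
      by (simp add: power2_eq_square)
  qed
  \<comment> \<open>Jordan's inequality covers \<open>2 * h \<le> m\<close>, and the reflection of
    \<open>h\<close> to \<open>m - h\<close> covers the rest. Keeping both summands gives one bound
    for all \<open>h\<close>, so the range need not be split.\<close>
  have "1 / (sin (pi * real h / real m))\<^sup>2
    \<le> (real m)\<^sup>2 / 4 * (1 / (real h)\<^sup>2 + 1 / (real (m - h))\<^sup>2)" if "h \<in> {1..<m}" for h
  proof (cases "2 * h \<le> m")
    case True
    have "(real m)\<^sup>2 / 4 * (1 / (real h)\<^sup>2) \<le> (real m)\<^sup>2 / 4 * (1 / (real h)\<^sup>2 + 1 / (real (m - h))\<^sup>2)"
      by (intro mult_left_mono) auto
    then show ?thesis
      using *[of h] True that by fastforce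
  next
    case False
    have "sin (pi * real (m - h) / real m) = sin (pi - pi * real h / real m)"
      using that by (simp add: of_nat_diff field_simps)
    then have "sin (pi * real (m - h) / real m) = sin (pi * real h / real m)"
      by simp
    moreover have "(real m)\<^sup>2 / 4 * (1 / (real (m - h))\<^sup>2)
        \<le> (real m)\<^sup>2 / 4 * (1 / (real h)\<^sup>2 + 1 / (real (m - h))\<^sup>2)"
      by (intro mult_left_mono) auto
    moreover have "m - h > 0" "2 * (m - h) \<le> m"
      using False that by auto
    ultimately show ?thesis
      using *[of "m - h"] by fastforce
  qed
  then have "(\<Sum>h=1..<m. 1 / (sin (pi * real h / real m))\<^sup>2)
      \<le> (\<Sum>h=1..<m. (real m)\<^sup>2 / 4 * (1 / (real h)\<^sup>2 + 1 / (real (m - h))\<^sup>2))"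
    by (rule sum_mono)
  also have "\<dots> = (real m)\<^sup>2 / 4 *
      ((\<Sum>h=1..<m. 1 / (real h)\<^sup>2) + (\<Sum>h=1..<m. 1 / (real (m - h))\<^sup>2))"
    by (simp only: sum.distrib flip: sum_distrib_left)
  also have "(\<Sum>h=1..<m. 1 / (real (m - h))\<^sup>2) = (\<Sum>h=1..<m. 1 / (real h)\<^sup>2)"
    by (rule sum.reindex_bij_witness[of _ "\<lambda>h. m - h" "\<lambda>h. m - h"]) auto
  also have "(real m)\<^sup>2 / 4 * ((\<Sum>h=1..<m. 1 / (real h)\<^sup>2) + (\<Sum>h=1..<m. 1 / (real h)\<^sup>2))
      \<le> (real m)\<^sup>2 / 4 * (2 + 2)"
    using sum_inverse_squares_le[of m] by (intro mult_left_mono) auto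
  finally show ?thesis
    by simp
qed

text \<open>The indicator of the residue class is expanded in characters modulo \<open>m\<close>.
  Frequency 0 yields the main term 1/m; the others are controlled by the exponential sum bound.
  Their inverse squared sines sum to at most m^2, and division by \<open>m\<close> leaves an error
  linear in \<open>m\<close>.\<close>

lemma residue_frequency:
  assumes "q \<ge> 2" "q ^ L \<le> N" "N < q ^ Suc L" "r < m"
  shows "\<bar>real (card {n. n < N \<and> digit_sum q n mod m = r}) / real N - 1 / real m\<bar>
    \<le> 4 * (real q)\<^sup>2 / real (Suc L) * real m"
proof -
  define z where "z h = cis (2 * pi * real h / real m)" for h
  define S where "S h = (\<Sum>n<N. z h ^ digit_sum q n)" for h
  define A where "A = card {n. n < N \<and> digit_sum q n mod m = r}"
  define K where "K = 4 * (real q)\<^sup>2 / real (Suc L)"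
  have "N > 0" "m > 0"
    using assms by (auto intro: Nat.gr0I)
  \<comment> \<open>Adding \<open>m - r\<close> instead of subtracting \<open>r\<close> keeps the
    exponents of the characters natural.\<close>
  have dvd: "m dvd s + (m - r) \<longleftrightarrow> s mod m = r" for s
  proof -
    have "m dvd s + (m - r) \<longleftrightarrow> int m dvd (int s - int r) + int m"
      using assms by (simp add: of_nat_diff algebra_simps flip: int_dvd_int_iff)
    also have "\<dots> \<longleftrightarrow> int s mod int m = int r mod int m"
      by (simp add: mod_eq_dvd_iff)
    also have "\<dots> \<longleftrightarrow> s mod m = r"
      using assms by (simp flip: of_nat_mod)
    finally show ?thesis .
  qed
  have "of_nat m * of_nat A = (\<Sum>n<N. if digit_sum q n mod m = r then (of_nat m :: complex) else 0)"
    unfolding A_def by (simp add: sum.If_cases Int_def lessThan_def conj_commute)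
  also have "\<dots> = (\<Sum>n<N. \<Sum>h<m. z h ^ (digit_sum q n + (m - r)))"
    unfolding z_def using \<open>m > 0\<close> by (simp add: sum_cis_multiples dvd)
  also have "\<dots> = (\<Sum>h<m. z h ^ (m - r) * S h)"
    by (subst sum.swap) (simp add: S_def power_add sum_distrib_left mult.commute)
  also have "\<dots> = of_nat N + (\<Sum>h=1..<m. z h ^ (m - r) * S h)"
    using \<open>m > 0\<close> by (simp add: lessThan_atLeast0 sum.atLeast_Suc_lessThan z_def S_def)
  finally have "complex_of_real (real m * real A - real N) = (\<Sum>h=1..<m. z h ^ (m - r) * S h)"
    by simp
  then have "\<bar>real m * real A - real N\<bar> = norm (\<Sum>h=1..<m. z h ^ (m - r) * S h)"
    by (metis norm_of_real real_norm_def)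
  also have "\<dots> \<le> (\<Sum>h=1..<m. real N * K * (1 / (sin (pi * real h / real m))\<^sup>2))"
  proof (rule sum_norm_le)
    fix h assume h: "h \<in> {1..<m}"
    \<comment> \<open>The half angle pi h/m lies strictly between 0 and pi, so the exponential sum
      bound applies.\<close>
    have "sin (pi * real h / real m) > 0"
      using h by (intro sin_gt_zero) (auto simp: field_simps)
    then have "norm (S h) \<le> real N * (4 * (real q)\<^sup>2 / (real (Suc L) * (sin (pi * real h / real m))\<^sup>2))"
      using norm_sum_cis_digit_sum_le[of q L N "2 * pi * real h / real m"] assms
      by (simp add: S_def z_def)
    then show "norm (z h ^ (m - r) * S h) \<le> real N * K * (1 / (sin (pi * real h / real m))\<^sup>2)"
      by (simp add: norm_mult norm_power z_def K_def)
  qed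
  also have "\<dots> = real N * K * (\<Sum>h=1..<m. 1 / (sin (pi * real h / real m))\<^sup>2)"
    by (simp only: sum_distrib_left)
  also have "\<dots> \<le> real N * K * (real m)\<^sup>2"
    by (intro mult_left_mono sum_inverse_sin_squares_le) (auto simp: K_def)
  finally have *: "\<bar>real m * real A - real N\<bar> \<le> real N * K * (real m)\<^sup>2" .
  have "real A / real N - 1 / real m = (real m * real A - real N) / (real N * real m)"
    using \<open>N > 0\<close> \<open>m > 0\<close> by (simp add: field_simps)
  then have "\<bar>real A / real N - 1 / real m\<bar> = \<bar>real m * real A - real N\<bar> / (real N * real m)"
    by (simp add: abs_mult)
  also have "\<dots> \<le> real N * K * (real m)\<^sup>2 / (real N * real m)"
    using * by (intro divide_right_mono) auto
  also have "\<dots> = K * real m"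
    using \<open>N > 0\<close> \<open>m > 0\<close> by (simp add: power2_eq_square)
  finally show ?thesis
    by (simp add: A_def K_def)
qed

subsection \<open>The van der Corput sequence\<close>

lemma van_der_corput_rec:
  assumes "b \<ge> 2"
  shows "van_der_corput b n = (real (n mod b) + van_der_corput b (n div b)) / real b"
proof -
  have summable: "summable (\<lambda>i. real (digit b n i) / real b ^ Suc i)" for n
  proof (rule summable_finite)
    show "finite {..n}"
      by simp
    fix i assume "i \<notin> {..n}"
    then have "n < 2 ^ i"
      by (meson atMost_iff less_exp not_le order.strict_trans)
    also have "\<dots> \<le> b ^ i"
      using assms by (intro power_mono) auto
    finally have "n < b ^ i" .
    then show "real (digit b n i) / real b ^ Suc i = 0"
      by (simp add: digit_def)
  qed
  have "van_der_corput b n = real (digit b n 0) / real b ^ Suc 0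
      + (\<Sum>i. real (digit b n (Suc i)) / real b ^ Suc (Suc i))"
    unfolding van_der_corput_def using suminf_split_head[OF summable[of n]] by simp
  also have "(\<Sum>i. real (digit b n (Suc i)) / real b ^ Suc (Suc i))
      = (\<Sum>i. real (digit b (n div b) i) / real b ^ Suc i / real b)"
    by (simp add: digit_Suc mult.commute)
  also have "\<dots> = van_der_corput b (n div b) / real b"
    unfolding van_der_corput_def by (rule suminf_divide[OF summable])
  finally show ?thesis
    by (simp add: digit_def add_divide_distrib)
qed

lemma van_der_corput_0: "van_der_corput b 0 = 0"
  by (simp add: van_der_corput_def digit_def)

lemma van_der_corput_bounds:
  assumes "b \<ge> 2"
  shows "0 \<le> van_der_corput b n \<and> van_der_corput b n < 1"
proof (induction n rule: less_induct)
  case (less n)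
  show ?case
  proof (cases "n = 0")
    case False
    then have IH: "0 \<le> van_der_corput b (n div b) \<and> van_der_corput b (n div b) < 1"
      using assms by (intro less.IH) simp
    have "n mod b + 1 \<le> b"
      using assms by (simp add: Suc_leI)
    then have "real (n mod b) + 1 \<le> real b"
      by linarith
    then show ?thesis
      using IH assms by (subst (1 2) van_der_corput_rec) (auto simp: divide_less_eq)
  qed (simp add: van_der_corput_0)
qed

text \<open>For \<open>b \<ge> 2\<close> this is the integer part of
  \<open>b ^ k * van_der_corput b n\<close>, that is, the index of the elementary interval of length
  1/b^k containing the point.\<close>

primrec reversed_digits :: "nat \<Rightarrow> nat \<Rightarrow> nat \<Rightarrow> nat" where
  "reversed_digits b 0 n = 0"
| "reversed_digits b (Suc k) n = b * reversed_digits b k n + digit b n k"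

lemma van_der_corput_reversed_digits:
  assumes "b \<ge> 2"
  shows "van_der_corput b n =
    (real (reversed_digits b k n) + van_der_corput b (n div b ^ k)) / real b ^ k"
proof (induction k)
  case (Suc k)
  have "van_der_corput b (n div b ^ k) =
      (real (digit b n k) + van_der_corput b (n div b ^ Suc k)) / real b"
    using van_der_corput_rec[OF assms, of "n div b ^ k"]
    by (simp add: digit_def mult.commute flip: div_mult2_eq)
  then show ?case
    using Suc assms by (simp add: field_simps)
qed simp

text \<open>The tail \<open>van_der_corput b (n div b ^ k)\<close> lies in [0,1), so it cannot
  affect a comparison with an integer after scaling by \<open>b ^ k\<close>.\<close>

lemma van_der_corput_less_iff:
  assumes "b \<ge> 2"
  shows "van_der_corput b n < real j / real b ^ k \<longleftrightarrow> reversed_digits b k n < j"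
proof -
  have "van_der_corput b n < real j / real b ^ k \<longleftrightarrow>
      real (reversed_digits b k n) + van_der_corput b (n div b ^ k) < real j"
    using assms by (subst van_der_corput_reversed_digits[OF assms, of n k])
      (simp add: divide_less_cancel)
  also have "\<dots> \<longleftrightarrow> reversed_digits b k n < j"
    using van_der_corput_bounds[OF assms, of "n div b ^ k"] by linarith
  finally show ?thesis .
qed

text \<open>Digit reversal permutes the strings of \<open>k\<close> digits, so membership in an
  elementary interval is a congruence modulo \<open>b ^ k\<close>.\<close>

lemma reversed_digits_eq_iff_mod_eq:
  assumes "b \<ge> 2" "j < b ^ k"
  shows "\<exists>r<b ^ k. \<forall>n. reversed_digits b k n = j \<longleftrightarrow> n mod b ^ k = r"
  using assms(2)
proof (induction k arbitrary: j)
  case (Suc k)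
  have "j div b < b ^ k"
    using Suc.prems assms by (simp add: div_less_iff_less_mult mult.commute)
  then obtain r where r: "r < b ^ k" "\<And>n. reversed_digits b k n = j div b \<longleftrightarrow> n mod b ^ k = r"
    using Suc.IH by blast
  \<comment> \<open>The last digit of \<open>j\<close> becomes the leading digit of the
    residue.\<close>
  define r' where "r' = j mod b * b ^ k + r"
  have "j mod b + 1 \<le> b"
    using assms by (simp add: Suc_leI)
  then have "(j mod b + 1) * b ^ k \<le> b * b ^ k"
    by (intro mult_le_mono) auto
  then have "r' < b ^ Suc k"
    using r(1) by (simp add: r'_def)
  moreover have "reversed_digits b (Suc k) n = j \<longleftrightarrow> n mod b ^ Suc k = r'" for n
  proof -
    have "digit b n k < b"
      using assms by (simp add: digit_def)
    have "reversed_digits b (Suc k) n = j \<longleftrightarrow>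
        reversed_digits b k n = j div b \<and> digit b n k = j mod b"
      using \<open>digit b n k < b\<close> by auto
    also have "\<dots> \<longleftrightarrow> n mod b ^ k = r \<and> digit b n k = j mod b"
      by (simp add: r)
    also have "\<dots> \<longleftrightarrow> digit b n k * b ^ k + n mod b ^ k = r'"
    proof
      assume *: "digit b n k * b ^ k + n mod b ^ k = r'"
      have "b ^ k > 0"
        using assms by simp
      then have "n mod b ^ k = r' mod b ^ k" "digit b n k = r' div b ^ k"
        by (simp_all flip: *)
      moreover have "r' div b ^ k = j mod b"
        using r(1) assms(1) by (simp add: r'_def)
      ultimately show "n mod b ^ k = r \<and> digit b n k = j mod b"
        using r(1) by (simp add: r'_def)
    qed (simp add: r'_def)
    also have "digit b n k * b ^ k + n mod b ^ k = n mod b ^ Suc k"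
      using mod_mult2_eq[of n "b ^ k" b] by (simp add: digit_def mult.commute)
    finally show ?thesis .
  qed
  ultimately show ?case
    by blast
qed simp

subsection \<open>From residue classes to discrepancy\<close>

text \<open>With \<open>i = j div b\<close>, the initial interval at level \<open>k + 1\<close> is
  one at level \<open>k\<close> plus fewer than \<open>b\<close> elementary intervals. The new
  errors grow geometrically with the level, so their total stays of order \<delta> b^k; adding up
  \<open>j\<close> elementary intervals of level \<open>k\<close> directly would give only \<delta>
  b^(2k).\<close>

lemma initial_interval_frequency:
  assumes "b \<ge> 2" and "\<delta> \<ge> 0" and "N > 0" and "j \<le> b ^ k"
    and freq: "\<And>k r. r < b ^ k \<Longrightarrow>
      \<bar>real (card {n. n < N \<and> y n mod b ^ k = r}) / real N - 1 / real (b ^ k)\<bar> \<le> \<delta> * real (b ^ k)"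
  shows "\<bar>real (card {n. n < N \<and> reversed_digits b k (y n) < j}) / real N - real j / real (b ^ k)\<bar>
    \<le> 2 * real b * \<delta> * real (b ^ k)"
  using \<open>j \<le> b ^ k\<close>
proof (induction k arbitrary: j)
  case 0
  then have "j = 0 \<or> j = 1"
    by auto
  then show ?case
    using assms by auto
next
  case (Suc k)
  define F where "F k j = card {n. n < N \<and> reversed_digits b k (y n) < j}" for k j
  define i where "i = j div b"
  have "i \<le> b ^ k"
    using div_le_mono[of j "b * b ^ k" b] Suc.prems assms by (simp add: i_def)
  \<comment> \<open>The grid point i/b^k reappears on the finer grid with numerator
    \<open>b * i\<close>.\<close>
  have base: "F (Suc k) (b * i) = F k i"
  proof -
    have "b * x + digit b n k < b * i \<longleftrightarrow> x < i" for x n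
    proof -
      have d: "digit b n k < b"
        using assms by (simp add: digit_def)
      have "b * x + digit b n k < b * i \<longleftrightarrow> (b * x + digit b n k) div b < i"
        using assms(1) by (subst div_less_iff_less_mult) (auto simp: mult.commute)
      then show ?thesis
        using d by simp
    qed
    then show ?thesis
      by (simp add: F_def)
  qed
  have step: "\<bar>real (F (Suc k) (b * i + d)) / real N - real (b * i + d) / real (b ^ Suc k)\<bar>
      \<le> 2 * real b * \<delta> * real (b ^ k) + real d * (\<delta> * real (b ^ Suc k))"
    if "b * i + d \<le> b ^ Suc k" for d
    using that
  proof (induction d)
    case 0
    show ?case
      using Suc.IH[OF \<open>i \<le> b ^ k\<close>] base assms by (simp add: F_def)
  next
    case (Suc d)
    let ?E = "{n. n < N \<and> reversed_digits b (Suc k) (y n) = b * i + d}"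
    have "b * i + d < b ^ Suc k"
      using Suc.prems by simp
    then obtain r where "r < b ^ Suc k"
      and r: "\<And>n. reversed_digits b (Suc k) n = b * i + d \<longleftrightarrow> n mod b ^ Suc k = r"
      using reversed_digits_eq_iff_mod_eq[OF assms(1)] by blast
    then have E: "\<bar>real (card ?E) / real N - 1 / real (b ^ Suc k)\<bar> \<le> \<delta> * real (b ^ Suc k)"
      unfolding r by (intro freq)
    have split: "{n. n < N \<and> reversed_digits b (Suc k) (y n) < b * i + Suc d} =
        {n. n < N \<and> reversed_digits b (Suc k) (y n) < b * i + d} \<union> ?E"
      by (auto simp del: reversed_digits.simps)
    have "F (Suc k) (b * i + Suc d) = F (Suc k) (b * i + d) + card ?E"
      unfolding F_def split by (rule card_Un_disjoint) (auto simp del: reversed_digits.simps)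
    then have "real (F (Suc k) (b * i + Suc d)) / real N - real (b * i + Suc d) / real (b ^ Suc k)
        = (real (F (Suc k) (b * i + d)) / real N - real (b * i + d) / real (b ^ Suc k))
          + (real (card ?E) / real N - 1 / real (b ^ Suc k))"
      by (simp add: add_divide_distrib del: reversed_digits.simps power_Suc of_nat_power)
    moreover have "real (Suc d) * (\<delta> * real (b ^ Suc k))
        = real d * (\<delta> * real (b ^ Suc k)) + \<delta> * real (b ^ Suc k)"
      by (simp add: distrib_right)
    moreover have "b * i + d \<le> b ^ Suc k"
      using Suc.prems by simp
    ultimately show ?case
      using E Suc.IH by linarith
  qed
  have j: "j = b * i + j mod b"
    by (simp add: i_def)
  have "j mod b \<le> b"
    using assms by (simp add: less_imp_le)
  have "\<bar>real (F (Suc k) j) / real N - real j / real (b ^ Suc k)\<bar>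
      \<le> 2 * real b * \<delta> * real (b ^ k) + real (j mod b) * (\<delta> * real (b ^ Suc k))"
    using step[of "j mod b"] Suc.prems unfolding j[symmetric] by blast
  also have "\<dots> \<le> real b * \<delta> * real (b ^ Suc k) + real b * (\<delta> * real (b ^ Suc k))"
  proof (rule add_mono)
    \<comment> \<open>Because \<open>b \<ge> 2\<close>, the error inherited from level
      \<open>k\<close> takes at most half of the bound at level \<open>k + 1\<close>; the other half
      is for the added intervals.\<close>
    have "2 * (real b * \<delta> * real (b ^ k)) \<le> real b * (real b * \<delta> * real (b ^ k))"
      using assms by (intro mult_right_mono) auto
    then show "2 * real b * \<delta> * real (b ^ k) \<le> real b * \<delta> * real (b ^ Suc k)"
      by (simp add: mult_ac)
    show "real (j mod b) * (\<delta> * real (b ^ Suc k)) \<le> real b * (\<delta> * real (b ^ Suc k))"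
      using assms \<open>j mod b \<le> b\<close> by (intro mult_right_mono) auto
  qed
  finally show ?case
    by (simp add: F_def mult_ac del: reversed_digits.simps)
qed

text \<open>The counting function \<open>F\<close> is monotone, so between neighbouring grid points
  it is off by at most the grid error plus the mesh 1/b^K. An interval is a difference of two
  initial intervals, whence the outer factor 2.\<close>

lemma discrepancy_van_der_corput_le:
  assumes "b \<ge> 2" and "\<delta> \<ge> 0" and "N > 0"
    and freq: "\<And>k r. r < b ^ k \<Longrightarrow>
      \<bar>real (card {n. n < N \<and> y n mod b ^ k = r}) / real N - 1 / real (b ^ k)\<bar> \<le> \<delta> * real (b ^ k)"
  shows "discrepancy N (\<lambda>n. van_der_corput b (y n)) \<le> 2 * (2 * real b * \<delta> * real (b ^ K) + 1 / real (b ^ K))"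
proof -
  define F where "F x = real (card {n. n < N \<and> van_der_corput b (y n) < x}) / real N" for x
  define M E where "M = real (b ^ K)" and "E = 2 * real b * \<delta> * real (b ^ K)"
  have "M > 0"
    using assms by (simp add: M_def)
  have mono: "F x \<le> F x'" if "x \<le> x'" for x x'
    unfolding F_def using that by (intro divide_right_mono) (auto intro!: card_mono)
  have grid: "\<bar>F (real j / M) - real j / M\<bar> \<le> E" if "j \<le> b ^ K" for j
    using initial_interval_frequency[OF assms(1-3) that freq]
    by (simp add: F_def M_def E_def van_der_corput_less_iff[OF assms(1)])
  have F: "\<bar>F x - x\<bar> \<le> E + 1 / M" if "0 \<le> x" "x \<le> 1" for x
  proof (cases "x = 1")
    case True
    have "\<bar>F 1 - 1\<bar> \<le> E"
      using grid[of "b ^ K"] assms(1) by (simp add: M_def)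
    then show ?thesis
      using True \<open>M > 0\<close> by (simp add: add_increasing2)
  next
    case False
    define j where "j = nat \<lfloor>x * M\<rfloor>"
    have "real j = of_int \<lfloor>x * M\<rfloor>"
      using that \<open>M > 0\<close> by (simp add: j_def)
    then have j: "real j \<le> x * M" "x * M < real (Suc j)"
      by linarith+
    \<comment> \<open>Excluding \<open>x = 1\<close> ensures that the upper neighbour
      \<open>Suc j\<close> is still a grid index.\<close>
    have "x * M < M"
      using False that \<open>M > 0\<close> by simp
    then have "real j < M"
      using j(1) by linarith
    then have "Suc j \<le> b ^ K"
      by (simp only: M_def of_nat_less_iff Suc_le_eq)
    have x: "real j / M \<le> x" "x \<le> real (Suc j) / M"
      using j \<open>M > 0\<close> by (simp_all add: field_simps)
    have "real (Suc j) / M = real j / M + 1 / M"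
      by (simp add: add_divide_distrib)
    then show ?thesis
      using grid[of j] grid[of "Suc j"] \<open>Suc j \<le> b ^ K\<close> mono[OF x(1)] mono[OF x(2)] x
      by linarith
  qed
  show ?thesis
    unfolding discrepancy_def
  proof (rule cSUP_least)
    have "(0, 1) \<in> {(a, c). 0 \<le> a \<and> a < c \<and> c \<le> (1::real)}"
      by simp
    then show "{(a, c). 0 \<le> a \<and> a < c \<and> c \<le> (1::real)} \<noteq> {}"
      by blast
    fix p :: "real \<times> real" assume "p \<in> {(a, c). 0 \<le> a \<and> a < c \<and> c \<le> 1}"
    then obtain a c where p: "p = (a, c)" "0 \<le> a" "a < c" "c \<le> 1"
      by auto
    have "{n. n < N \<and> van_der_corput b (y n) \<in> {a..<c}} =
        {n. n < N \<and> van_der_corput b (y n) < c} - {n. n < N \<and> van_der_corput b (y n) < a}"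
      by auto
    moreover have "{n. n < N \<and> van_der_corput b (y n) < a} \<subseteq> {n. n < N \<and> van_der_corput b (y n) < c}"
      using p by auto
    ultimately have "real (card {n. n < N \<and> van_der_corput b (y n) \<in> {a..<c}}) =
        real (card {n. n < N \<and> van_der_corput b (y n) < c}) - real (card {n. n < N \<and> van_der_corput b (y n) < a})"
      by (simp add: card_Diff_subset of_nat_diff card_mono)
    then have eq: "real (card {n. n < N \<and> van_der_corput b (y n) \<in> {a..<c}}) / real N = F c - F a"
      by (simp add: F_def diff_divide_distrib)
    have "\<bar>F a - a\<bar> \<le> E + 1 / M" "\<bar>F c - c\<bar> \<le> E + 1 / M"
      using p by (auto intro!: F)
    then have "\<bar>F c - F a - (c - a)\<bar> \<le> 2 * (E + 1 / M)"
      unfolding abs_le_iff by argo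
    then show "(case p of (a, c) \<Rightarrow> \<bar>real (card {n. n < N \<and> van_der_corput b (y n) \<in> {a..<c}}) / real N - (c - a)\<bar>)
        \<le> 2 * (2 * real b * \<delta> * real (b ^ K) + 1 / real (b ^ K))"
      by (simp only: p(1) prod.case eq E_def M_def)
  qed
qed

section \<open>Balancing the grid error against the mesh\<close>

theorem theorem3:
  fixes b q :: nat
  assumes "b \<ge> 2" and "q \<ge> 2" and "q < 14"
  shows "\<exists>C::real. C > 0 \<and>
    (\<forall>\<^sub>F N in sequentially.
       discrepancy N (\<lambda>n. van_der_corput b (digit_sum q n)) \<le> C / sqrt (ln (real N)))"
proof -
  \<comment> \<open>\<open>B / R\<close> is the value of 2(2b \<delta> R + b/R) for \<delta> =
    4q^2/R^2, where R^2 = L + 1. The factor sqrt(ln q) in \<open>C\<close> converts \<open>R\<close>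
    to sqrt(ln N), as N < q^(L+1).\<close>
  define B where "B = 16 * real b * (real q)\<^sup>2 + 2 * real b"
  define C where "C = B * sqrt (ln (real q))"
  have "B > 0"
    using assms by (simp add: B_def add_pos_pos)
  have "ln (real q) > 0"
    using assms by simp
  then have "C > 0"
    using \<open>B > 0\<close> by (simp add: C_def)
  have "discrepancy N (\<lambda>n. van_der_corput b (digit_sum q n)) \<le> C / sqrt (ln (real N))"
    if "N \<ge> 2" for N
  proof -
    have "N \<ge> 1"
      using that by simp
    then obtain L where L: "q ^ L \<le> N" "N < q ^ Suc L"
      using ex_power_ivl1[OF assms(2)] by auto
    define R where "R = sqrt (real (Suc L))"
    have "R \<ge> 1" "R * R = real (Suc L)"
      by (simp_all add: R_def)
    \<comment> \<open>\<open>b ^ K\<close> is the largest power of \<open>b\<close> not exceeding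
      \<open>R\<close>, so it lies between R/b and R; both error terms are then of order
      1/R.\<close>
    obtain K where K: "b ^ K \<le> nat \<lfloor>R\<rfloor>" "nat \<lfloor>R\<rfloor> < b ^ Suc K"
      using ex_power_ivl1[of b "nat \<lfloor>R\<rfloor>"] assms \<open>R \<ge> 1\<close> by (auto simp: le_nat_iff)
    have K1: "real (b ^ K) \<le> R"
      using K(1) \<open>R \<ge> 1\<close> by (simp add: le_nat_iff le_floor_iff del: of_nat_power)
    have K2: "R \<le> real b * real (b ^ K)"
    proof -
      have "R < real (nat \<lfloor>R\<rfloor>) + 1"
        using \<open>R \<ge> 1\<close> by simp
      also have "\<dots> \<le> real (b ^ Suc K)"
        using K(2) by linarith
      finally show ?thesis
        by simp
    qed
    define \<delta> where "\<delta> = 4 * (real q)\<^sup>2 / real (Suc L)"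
    have "discrepancy N (\<lambda>n. van_der_corput b (digit_sum q n))
        \<le> 2 * (2 * real b * \<delta> * real (b ^ K) + 1 / real (b ^ K))"
    proof (rule discrepancy_van_der_corput_le)
      fix k r assume "r < b ^ k"
      then show "\<bar>real (card {n. n < N \<and> digit_sum q n mod b ^ k = r}) / real N - 1 / real (b ^ k)\<bar>
          \<le> \<delta> * real (b ^ k)"
        unfolding \<delta>_def using assms L by (intro residue_frequency)
    qed (use assms that in \<open>auto simp: \<delta>_def\<close>)
    also have "\<dots> \<le> 2 * (2 * real b * \<delta> * R + real b / R)"
    proof -
      have "1 / real (b ^ K) \<le> real b / R"
        using K2 assms \<open>R \<ge> 1\<close> by (simp add: field_simps)
      moreover have "2 * real b * \<delta> * real (b ^ K) \<le> 2 * real b * \<delta> * R"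
        using K1 by (intro mult_left_mono) (auto simp: \<delta>_def)
      ultimately have "2 * real b * \<delta> * real (b ^ K) + 1 / real (b ^ K) \<le> 2 * real b * \<delta> * R + real b / R"
        by (rule add_mono[rotated])
      then show ?thesis
        by (rule mult_left_mono) simp
    qed
    also have "\<dots> = B / R"
      unfolding \<delta>_def \<open>R * R = real (Suc L)\<close>[symmetric] using \<open>R \<ge> 1\<close>
      by (simp add: B_def field_simps)
    also have "\<dots> \<le> C / sqrt (ln (real N))"
    proof -
      have "real N \<le> real q ^ Suc L"
        using L(2) by (metis less_imp_le of_nat_le_iff of_nat_power)
      then have "ln (real N) \<le> ln (real q ^ Suc L)"
        using that by (intro ln_mono) auto
      also have "\<dots> = real (Suc L) * ln (real q)"
        using assms by (subst ln_realpow) auto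
      finally have "sqrt (ln (real N)) \<le> R * sqrt (ln (real q))"
        unfolding R_def real_sqrt_mult[symmetric] by (rule real_sqrt_le_mono)
      moreover have "sqrt (ln (real N)) > 0"
        using that by simp
      ultimately show ?thesis
        using \<open>B > 0\<close> \<open>R \<ge> 1\<close> by (simp add: C_def field_simps)
    qed
    finally show ?thesis .
  qed
  then show ?thesis
    using \<open>C > 0\<close> by (intro exI[of _ C] conjI eventually_sequentiallyI[of 2])
qed

end
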